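(* For every integer $n\ge 3$, $$i(G_{3,2})=\gamma(G_{3,2})=\binom{n}{2}-\left\lfloor\frac{(n+1)^2}{8}\right\rfloor .$$
   Context: For a positive integer $n$, $[n]=\{1,2,\dots,n\}$ and $\binom{[n]}{k}$ is the set of $k$-element subsets of $[n]$. For $1\le k<l\le n$, $G_{l,k}$ is the bipartite graph with vertex set $\binom{[n]}{k}\cup\binom{[n]}{l}$ in which $A\in\binom{[n]}{k}$ and $B\in\binom{[n]}{l}$ are adjacent if and only if $A\subseteq B$ (there are no other edges). So $G_{3,2}$ has as vertices the $2$-element and the $3$-element subsets of $[n]$. A vertex set $D\subseteq V$ of a graph $G=(V,E)$ is dominating if every vertex $v\in V\setminus D$ has a neighbor in $D$. The domination number $\gamma(G)$ is the minimum size of a dominating set of $G$. The independent domination number $i(G)$ is the minimum size of a dominating set of $G$ that is also an independent set (no two of its vertices are adjacent). *)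

theory Defs
  imports Complex_Main
begin

text \<open>A graph is a pair of a vertex set and a set of edges, an edge being the set of its two ends.\<close>

type_synonym 'a ugraph = "'a set \<times> 'a set set"

definition verts :: "'a ugraph \<Rightarrow> 'a set" where
  "verts G = fst G"

definition edges :: "'a ugraph \<Rightarrow> 'a set set" where
  "edges G = snd G"

definition adjacent :: "'a ugraph \<Rightarrow> 'a \<Rightarrow> 'a \<Rightarrow> bool" where
  "adjacent G u v \<longleftrightarrow> {u, v} \<in> edges G"

definition dominating :: "'a ugraph \<Rightarrow> 'a set \<Rightarrow> bool" where
  "dominating G D \<longleftrightarrow> D \<subseteq> verts G \<and> (\<forall>v \<in> verts G - D. \<exists>u \<in> D. adjacent G v u)"

definition independent_vertices :: "'a ugraph \<Rightarrow> 'a set \<Rightarrow> bool" where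
  "independent_vertices G D \<longleftrightarrow> D \<subseteq> verts G \<and> (\<forall>u \<in> D. \<forall>v \<in> D. \<not> adjacent G u v)"

text \<open>The next two numbers are meant for finite graphs only: \<open>card\<close> is 0 on infinite sets.\<close>

definition domination_number :: "'a ugraph \<Rightarrow> nat" where
  "domination_number G = (LEAST m. \<exists>D. dominating G D \<and> card D = m)"

definition independent_domination_number :: "'a ugraph \<Rightarrow> nat" where
  "independent_domination_number G =
     (LEAST m. \<exists>D. dominating G D \<and> independent_vertices G D \<and> card D = m)"

definition subsets_of_size :: "nat \<Rightarrow> nat \<Rightarrow> nat set set" where
  "subsets_of_size n k = {A. A \<subseteq> {1..n} \<and> card A = k}"

text \<open>The graph \<open>G\<^sub>l\<^sub>,\<^sub>k\<close> over the ground set \<open>{1..n}\<close>; it is meant for \<open>1 \<le> k < l \<le> n\<close>,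
  where the two vertex classes are disjoint and there are no loops.\<close>

definition inclusion_graph :: "nat \<Rightarrow> nat \<Rightarrow> nat \<Rightarrow> nat set ugraph" where
  "inclusion_graph n l k =
     (subsets_of_size n k \<union> subsets_of_size n l,
      {{A, B} |A B. A \<in> subsets_of_size n k \<and> B \<in> subsets_of_size n l \<and> A \<subseteq> B})"

end

theory Submission
  imports Defs
begin

text \<open>Let \<open>D\<close> be dominating, let \<open>H\<close> be the graph on \<open>[n]\<close> formed by the pairs outside \<open>D\<close>, and let
  \<open>T\<close> be the set of triples in \<open>D\<close>. Then \<open>T\<close> contains all triangles of \<open>H\<close>, every edge of \<open>H\<close> lies
  in a member of \<open>T\<close>, and \<open>|D| = (n choose 2) - (e(H) - |T|)\<close>. Let \<open>v\<close> be a vertex of maximum degree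
  \<open>d\<close> in \<open>H\<close>, with neighbourhood \<open>N\<close>. Send a pair \<open>(u, w)\<close> of adjacent vertices with \<open>u \<in> N\<close>, \<open>w \<noteq> v\<close> to
  the triangle \<open>{v, u, w}\<close> if \<open>w \<in> N\<close>, and to a member of \<open>T\<close> covering \<open>{u, w}\<close> otherwise; no member of
  \<open>T\<close> is used more than twice, so the degrees in \<open>N\<close> add up to at most \<open>d + 2|T|\<close>. The
  remaining \<open>n - d\<close> degrees are at most \<open>d\<close>, hence \<open>2 (e(H) - |T|) \<le> d (n + 1 - d) \<le> (n + 1)\<^sup>2 / 4\<close>.

  For equality, join every vertex of \<open>{1..a}\<close> to all of the \<open>2 b = n - a\<close> other vertices, add a perfect
  matching on the latter, and let \<open>T\<close> be the set of triangles; then \<open>e(H) - |T| = (a + 1) b\<close>.\<close>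

section \<open>Counting edges when triples cover all edges and triangles\<close>

text \<open>Bounds the charge on one triple. If \<open>v \<in> t\<close>, both entries lie in the
  two-element set \<open>t - {v}\<close>, which has two orderings. Otherwise the pairs lie in
  \<open>(N \<inter> t) \<times> (W \<inter> t)\<close>, and disjoint parts of a triple have sizes
  with product at most 2.\<close>

lemma card_pairs_in_triple_le:
  assumes "card t = 3" "v \<notin> N" "v \<notin> W" "N \<inter> W = {}"
  shows "card {(u, w). u \<in> N \<inter> t \<and> w \<in> t \<and> u \<noteq> w \<and> (w \<in> W \<or> w \<in> N \<and> v \<in> t)} \<le> 2"
    (is "card ?F \<le> 2")
proof (cases "v \<in> t")
  case True
  then have "card (t - {v}) = 2"
    using assms(1) by simp
  then obtain p q where pq: "t - {v} = {p, q}"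
    by (auto simp: card_2_iff)
  have "?F \<subseteq> {(x, y). x \<in> t - {v} \<and> y \<in> t - {v} \<and> x \<noteq> y}"
    using assms(2,3) by auto
  also have "\<dots> \<subseteq> {(p, q), (q, p)}"
    unfolding pq by auto
  finally have "card ?F \<le> card {(p, q), (q, p)}"
    by (intro card_mono) auto
  also have "\<dots> \<le> 2"
    using card_length[of "[(p, q), (q, p)]"] by simp
  finally show ?thesis .
next
  case False
  have fin: "finite t"
    using assms(1) by (metis card.infinite zero_neq_numeral)
  have "?F \<subseteq> (N \<inter> t) \<times> (W \<inter> t)"
    using False by auto
  then have F: "card ?F \<le> card (N \<inter> t) * card (W \<inter> t)"
    unfolding card_cartesian_product[symmetric] using fin by (intro card_mono) auto
  have "card (N \<inter> t) + card (W \<inter> t) = card (N \<inter> t \<union> W \<inter> t)"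
    using fin assms(4) by (intro card_Un_disjoint[symmetric]) auto
  also have "\<dots> \<le> 3"
    unfolding assms(1)[symmetric] using fin by (intro card_mono) auto
  finally have s: "card (N \<inter> t) + card (W \<inter> t) \<le> 3" .
  then consider "card (N \<inter> t) = 0" | "card (N \<inter> t) = 1" | "card (N \<inter> t) = 2" | "card (W \<inter> t) = 0"
    by linarith
  then have "card (N \<inter> t) * card (W \<inter> t) \<le> 2"
    using s by cases auto
  with F show ?thesis
    by simp
qed

text \<open>Arithmetic-geometric mean for the factors \<open>x\<close> and \<open>y + 1\<close>:
  over the integers the two sides differ by (x - y - 1)^2.\<close>

lemma four_mult_le_square: "4 * (x * (y + 1)) \<le> (x + y + 1)^2" for x y :: nat
proof -
  have "0 \<le> (int x - int y - 1)^2"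
    by simp
  then have "int (4 * (x * (y + 1))) \<le> int ((x + y + 1)^2)"
    by (simp add: power2_eq_square algebra_simps)
  then show ?thesis
    by linarith
qed

text \<open>\<open>R\<close> holds each edge of H in both directions, so \<open>card R\<close> is 2
  e(H), and the bound is 8 (e(H) - |T|) \<le> (|V| + 1)^2 freed of subtraction.\<close>

lemma card_edges_le_if_triangles_cover:
  fixes R :: "('a \<times> 'a) set"
  assumes V: "finite V" and RV: "R \<subseteq> V \<times> V" and sym: "sym R" and irr: "\<And>x. (x, x) \<notin> R"
    and fT: "finite T" and T: "\<And>t. t \<in> T \<Longrightarrow> card t = 3"
    and tri: "\<And>x y z. (x, y) \<in> R \<Longrightarrow> (y, z) \<in> R \<Longrightarrow> (x, z) \<in> R \<Longrightarrow> {x, y, z} \<in> T"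
    and cov: "\<And>x y. (x, y) \<in> R \<Longrightarrow> \<exists>t\<in>T. x \<in> t \<and> y \<in> t"
  shows "4 * card R \<le> (card V + 1)^2 + 8 * card T"
proof (cases "V = {}")
  case True
  then show ?thesis
    using RV by auto
next
  case False
  let ?d = "\<lambda>u. card (R `` {u})"
  have "Max (?d ` V) \<in> ?d ` V"
    using V False by (intro Max_in) auto
  then obtain v where v: "v \<in> V" and "?d v = Max (?d ` V)"
    by auto
  then have max: "?d u \<le> ?d v" if "u \<in> V" for u
    using that V by simp
  define N where "N = R `` {v}"
  define W where "W = V - N - {v}"
  have NV: "N \<subseteq> V" and vN: "v \<notin> N"
    using RV irr by (auto simp: N_def)
  have finN: "finite N"
    using NV V finite_subset by blast
  have fimg: "finite (R `` {u})" for u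
    by (rule finite_subset[OF _ V]) (use RV in auto)
  have "R = Sigma V (\<lambda>u. R `` {u})"
    using RV by auto
  then have "card R = (\<Sum>u\<in>V. ?d u)"
    using V fimg by (metis (no_types, lifting) card_SigmaI sum.cong)
  also have "\<dots> = (\<Sum>u\<in>V - N. ?d u) + (\<Sum>u\<in>N. ?d u)"
    using sum.subset_diff[OF NV V] .
  finally have cR: "card R = (\<Sum>u\<in>V - N. ?d u) + (\<Sum>u\<in>N. ?d u)" .
  have out: "(\<Sum>u\<in>V - N. ?d u) \<le> card (V - N) * card N"
    using sum_bounded_above[of "V - N" ?d "card N"] max by (simp add: N_def)
  \<comment> \<open>The pairs charged to \<open>t\<close>. For \<open>w \<in> N\<close> the
    condition \<open>v \<in> t\<close> matters: without it a triple inside \<open>N\<close> could be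
    charged for six pairs.\<close>
  define F where "F t = {(u, w). u \<in> N \<inter> t \<and> w \<in> t \<and> u \<noteq> w \<and> (w \<in> W \<or> w \<in> N \<and> v \<in> t)}" for t
  \<comment> \<open>The pairs leading back to \<open>v\<close> are kept apart as
    \<open>N \<times> {v}\<close>; they contribute \<open>card N\<close>.\<close>
  have "Sigma N (\<lambda>u. R `` {u}) \<subseteq> N \<times> {v} \<union> (\<Union>t\<in>T. F t)"
  proof safe
    fix u w assume u: "u \<in> N" and uw: "(u, w) \<in> R" and "(u, w) \<notin> (\<Union>t\<in>T. F t)"
    then have nF: "\<And>t. t \<in> T \<Longrightarrow> (u, w) \<notin> F t"
      by auto
    have ne: "u \<noteq> w"
      using uw irr by auto
    show "w = v"
    proof (rule ccontr)
      assume wv: "w \<noteq> v"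
      show False
      proof (cases "w \<in> N")
        case True
        then have "{v, u, w} \<in> T"
          using tri[of v u w] u uw by (auto simp: N_def)
        then show False
          using nF[of "{v, u, w}"] True u ne by (auto simp: F_def)
      next
        case False
        then have "w \<in> W"
          using wv uw RV by (auto simp: W_def)
        then show False
          using cov[OF uw] nF u ne by (auto simp: F_def)
      qed
    qed
  qed
  moreover have finF: "finite (F t)" if "t \<in> T" for t
  proof (rule finite_subset)
    show "F t \<subseteq> t \<times> t"
      by (auto simp: F_def)
    show "finite (t \<times> t)"
      using T[OF that] by (metis card.infinite finite_cartesian_product zero_neq_numeral)
  qed
  ultimately have "card (Sigma N (\<lambda>u. R `` {u})) \<le> card (N \<times> {v} \<union> (\<Union>t\<in>T. F t))"
    using finN fT by (intro card_mono) auto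
  also have "\<dots> \<le> card (N \<times> {v}) + card (\<Union>t\<in>T. F t)"
    by (rule card_Un_le)
  also have "card (\<Union>t\<in>T. F t) \<le> (\<Sum>t\<in>T. card (F t))"
    by (rule card_UN_le[OF fT])
  also have "\<dots> \<le> card T * 2"
    using sum_bounded_above[of T "\<lambda>t. card (F t)" 2] card_pairs_in_triple_le[of _ v N W] T vN
    by (auto simp: F_def W_def)
  finally have "(\<Sum>u\<in>N. ?d u) \<le> card N + 2 * card T"
    using finN fimg by (simp add: card_cartesian_product)
  \<comment> \<open>The pairs back to \<open>v\<close> raise the factor \<open>card (V - N)\<close>
    from \<open>out\<close> by one.\<close>
  then have "4 * card R \<le> 4 * (card N * (card (V - N) + 1)) + 8 * card T"
    using cR out by (simp add: algebra_simps)
  also have "\<dots> \<le> (card N + card (V - N) + 1)^2 + 8 * card T"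
    using four_mult_le_square by simp
  also have "card N + card (V - N) = card V"
    using NV V finN by (simp add: card_Diff_subset card_mono)
  finally show ?thesis .
qed

section \<open>Lower bound for dominating sets of the inclusion graph\<close>

lemma card_symmetric_pairs:
  assumes "finite E" "\<And>e. e \<in> E \<Longrightarrow> card e = 2"
  shows "card {(x, y). {x, y} \<in> E} = 2 * card E"
proof -
  have two: "card {(x, y). {x, y} = e} = 2 \<and> finite {(x, y). {x, y} = e}" if "e \<in> E" for e
  proof -
    obtain p q where "e = {p, q}" "p \<noteq> q"
      using assms(2)[OF \<open>e \<in> E\<close>] by (metis card_2_iff)
    then have "{(x, y). {x, y} = e} = {(p, q), (q, p)}"
      by (auto simp: doubleton_eq_iff)
    with \<open>p \<noteq> q\<close> show ?thesis
      by simp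
  qed
  have "{(x, y). {x, y} \<in> E} = (\<Union>e\<in>E. {(x, y). {x, y} = e})"
    by auto
  also have "card \<dots> = (\<Sum>e\<in>E. card {(x, y). {x, y} = e})"
    using assms(1) two by (intro card_UN_disjoint) auto
  also have "\<dots> = (\<Sum>e\<in>E. 2)"
    using two by (intro sum.cong) auto
  finally show ?thesis
    by simp
qed

lemma finite_subsets_of_size: "finite (subsets_of_size n k)"
  by (rule finite_subset[of _ "Pow {1..n}"]) (auto simp: subsets_of_size_def)

lemma card_subsets_of_size: "card (subsets_of_size n k) = n choose k"
  using n_subsets[of "{1..n}" k] by (simp add: subsets_of_size_def)

lemma subsets_of_size_disjoint: "k \<noteq> l \<Longrightarrow> subsets_of_size n k \<inter> subsets_of_size n l = {}"
  by (auto simp: subsets_of_size_def)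

lemma verts_inclusion_graph:
  "verts (inclusion_graph n l k) = subsets_of_size n k \<union> subsets_of_size n l"
  by (simp add: verts_def inclusion_graph_def)

lemma adjacent_inclusion_graph_iff:
  "adjacent (inclusion_graph n l k) A B \<longleftrightarrow>
     A \<in> subsets_of_size n k \<and> B \<in> subsets_of_size n l \<and> A \<subseteq> B \<or>
     B \<in> subsets_of_size n k \<and> A \<in> subsets_of_size n l \<and> B \<subseteq> A"
  unfolding adjacent_def edges_def inclusion_graph_def by (auto simp: doubleton_eq_iff)

lemma dominating_inclusion_graph_iff:
  assumes "k \<noteq> l"
  shows "dominating (inclusion_graph n l k) D \<longleftrightarrow>
    D \<subseteq> subsets_of_size n k \<union> subsets_of_size n l \<and>
    (\<forall>A \<in> subsets_of_size n k - D. \<exists>B \<in> D \<inter> subsets_of_size n l. A \<subseteq> B) \<and>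
    (\<forall>B \<in> subsets_of_size n l - D. \<exists>A \<in> D \<inter> subsets_of_size n k. A \<subseteq> B)"
  using subsets_of_size_disjoint[OF assms, of n]
  unfolding dominating_def verts_inclusion_graph adjacent_inclusion_graph_iff by blast

text \<open>Domination supplies the hypotheses of \<open>card_edges_le_if_triangles_cover\<close>: a
  pair outside \<open>D\<close> needs a triple of \<open>D\<close> above it, and a triple with all
  its pairs outside \<open>D\<close> must itself be in \<open>D\<close>.\<close>

lemma card_dominating_ge:
  assumes "dominating (inclusion_graph n 3 2) D"
  shows "n choose 2 \<le> card D + (n + 1)^2 div 8"
proof -
  let ?P = "\<lambda>k. subsets_of_size n k"
  define E where "E = ?P 2 - D"
  define T where "T = D \<inter> ?P 3"
  define R where "R = {(x, y). {x, y} \<in> E}"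
  have D: "D \<subseteq> ?P 2 \<union> ?P 3"
    and D2: "\<And>A. A \<in> ?P 2 - D \<Longrightarrow> \<exists>B \<in> D \<inter> ?P 3. A \<subseteq> B"
    and D3: "\<And>B. B \<in> ?P 3 - D \<Longrightarrow> \<exists>A \<in> D \<inter> ?P 2. A \<subseteq> B"
    using assms by (auto simp: dominating_inclusion_graph_iff)
  have E: "card e = 2" "e \<subseteq> {1..n}" if "e \<in> E" for e
    using that by (auto simp: E_def subsets_of_size_def)
  have finE: "finite E" and finT: "finite T"
    by (auto simp: E_def T_def finite_subsets_of_size)
  have irr: "(x, x) \<notin> R" for x
    using E(1)[of "{x}"] by (auto simp: R_def)
  have "4 * card R \<le> (card {1..n} + 1)^2 + 8 * card T"
  proof (rule card_edges_le_if_triangles_cover)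
    show "R \<subseteq> {1..n} \<times> {1..n}"
      using E(2) by (fastforce simp: R_def)
    show "sym R"
      by (auto simp: sym_def R_def insert_commute)
    show "card t = 3" if "t \<in> T" for t
      using that by (auto simp: T_def subsets_of_size_def)
    show "\<exists>t\<in>T. x \<in> t \<and> y \<in> t" if "(x, y) \<in> R" for x y
      using D2[of "{x, y}"] that by (auto simp: R_def E_def T_def)
    show "{x, y, z} \<in> T" if xy: "(x, y) \<in> R" and yz: "(y, z) \<in> R" and xz: "(x, z) \<in> R" for x y z
    proof -
      have "x \<noteq> y" "y \<noteq> z" "x \<noteq> z"
        using xy yz xz irr by auto
      then have t: "{x, y, z} \<in> ?P 3"
        using xy yz E(2) by (force simp: R_def subsets_of_size_def)
      have "A \<in> E" if A: "A \<in> ?P 2" "A \<subseteq> {x, y, z}" for A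
      proof -
        have "card A = 2"
          using A(1) by (simp add: subsets_of_size_def)
        then obtain p q where "A = {p, q}" "p \<noteq> q"
          by (metis card_2_iff)
        then show ?thesis
          using A(2) xy yz xz by (auto simp: R_def insert_commute)
      qed
      then show ?thesis
        using D3[of "{x, y, z}"] t by (auto simp: T_def E_def)
    qed
  qed (use irr finT in auto)
  moreover have "card R = 2 * card E"
    unfolding R_def using finE E(1) by (rule card_symmetric_pairs)
  \<comment> \<open>This is 8 e(H) \<le> (n + 1)^2 + 8 |T| divided by 8; integrality allows rounding
    down.\<close>
  ultimately have "card E \<le> card T + (n + 1)^2 div 8"
    by simp
  moreover have "card D = card (D \<inter> ?P 2) + card T"
  proof -
    have "D = D \<inter> ?P 2 \<union> T"
      using D by (auto simp: T_def)
    moreover have "(D \<inter> ?P 2) \<inter> T = {}"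
      using subsets_of_size_disjoint[of 2 3 n] by (auto simp: T_def)
    ultimately show ?thesis
      by (metis card_Un_disjoint finT finite_Int finite_subsets_of_size)
  qed
  moreover have "card (D \<inter> ?P 2) + card E = n choose 2"
  proof -
    have "?P 2 = D \<inter> ?P 2 \<union> E"
      by (auto simp: E_def)
    moreover have "(D \<inter> ?P 2) \<inter> E = {}"
      by (auto simp: E_def)
    ultimately show ?thesis
      by (metis card_Un_disjoint finE finite_Int finite_subsets_of_size card_subsets_of_size)
  qed
  ultimately show ?thesis
    by linarith
qed

section \<open>An independent dominating set of small size\<close>

text \<open>The graph removed has 2 a b + b edges and at most a b triples are added, a gain of at
  least (a + 1) b.\<close>

lemma independent_dominating_set_construction:
  assumes n: "n = a + 2 * b" and a: "a \<ge> 1" and b: "b \<ge> 1"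
  obtains D where "dominating (inclusion_graph n 3 2) D"
    "independent_vertices (inclusion_graph n 3 2) D"
    "card D + (a + 1) * b \<le> n choose 2"
proof -
  let ?P = "\<lambda>k. subsets_of_size n k"
  \<comment> \<open>\<open>l i\<close> and \<open>r i\<close> with \<open>i < b\<close> run through
    \<open>a + 1, ..., n\<close> in consecutive pairs, the edges of the matching
    \<open>M\<close>.\<close>
  define l r where "l i = a + 2 * i + 1" and "r i = a + 2 * i + 2" for i :: nat
  define K where "K = (\<lambda>(x, y). {x, y}) ` ({1..a} \<times> {a+1..n})"
  define M where "M = (\<lambda>i. {l i, r i}) ` {..<b}"
  define T where "T = (\<lambda>(x, i). {x, l i, r i}) ` ({1..a} \<times> {..<b})"
  define D where "D = (?P 2 - (K \<union> M)) \<union> T"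
  have KI: "{x, y} \<in> K" "{y, x} \<in> K" if "x \<in> {1..a}" "y \<in> {a+1..n}" for x y
    using that by (auto simp: K_def insert_commute intro!: image_eqI[of _ _ "(x, y)"])
  have range: "l i \<in> {a+1..n}" "r i \<in> {a+1..n}" "l i \<noteq> r i" if "i < b" for i
    using that by (auto simp: l_def r_def n)
  have ex: "\<exists>i<b. y = l i \<or> y = r i" if "y \<in> {a+1..n}" for y
  proof -
    have "(y - a - 1) div 2 < b"
      using that n by auto
    moreover have "y = l ((y - a - 1) div 2) \<or> y = r ((y - a - 1) div 2)"
      using that by (simp add: l_def r_def) presburger
    ultimately show ?thesis
      by blast
  qed
  have T3: "T \<subseteq> ?P 3"
    using range by (fastforce simp: T_def subsets_of_size_def n)
  have K2: "K \<subseteq> ?P 2"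
    by (force simp: K_def subsets_of_size_def n)
  have M2: "M \<subseteq> ?P 2"
    using range by (force simp: M_def subsets_of_size_def n)
  \<comment> \<open>This yields independence: no pair below a member of \<open>T\<close> is left in
    \<open>D\<close>.\<close>
  have pairT: "A \<in> K \<union> M" if "t \<in> T" and A: "A \<in> ?P 2" "A \<subseteq> t" for A t
  proof -
    obtain x i where xi: "x \<in> {1..a}" "i < b" "t = {x, l i, r i}"
      using \<open>t \<in> T\<close> by (auto simp: T_def)
    have "card A = 2"
      using A(1) by (simp add: subsets_of_size_def)
    then obtain p q where pq: "A = {p, q}" "p \<noteq> q"
      by (metis card_2_iff)
    have "{l i, r i} \<in> M"
      using xi by (auto simp: M_def)
    then show ?thesis
      using pq xi A(2) KI[OF xi(1) range(1)[OF xi(2)]] KI[OF xi(1) range(2)[OF xi(2)]]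
      by (auto simp: insert_commute)
  qed
  have coverT: "\<exists>t\<in>T. A \<subseteq> t" if "A \<in> K \<union> M" for A
  proof -
    have tI: "{x, l i, r i} \<in> T" if "x \<in> {1..a}" "i < b" for x i
      using that by (auto simp: T_def)
    from that show ?thesis
    proof
      assume "A \<in> K"
      then obtain x y where xy: "x \<in> {1..a}" "y \<in> {a+1..n}" "A = {x, y}"
        by (auto simp: K_def)
      from ex[OF xy(2)] obtain i where "i < b" "y = l i \<or> y = r i"
        by auto
      with tI[OF xy(1), of i] xy(3) show ?thesis
        by (intro bexI[of _ "{x, l i, r i}"]) auto
    next
      assume "A \<in> M"
      then obtain i where "i < b" "A = {l i, r i}"
        by (auto simp: M_def)
      \<comment> \<open>A matching edge needs some apex in \<open>{1..a}\<close>; 1 is available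
        since \<open>a \<ge> 1\<close>.\<close>
      with tI[of 1 i] a show ?thesis
        by (intro bexI[of _ "{1, l i, r i}"]) auto
    qed
  qed
  \<comment> \<open>Exactly one end is at most \<open>a\<close>, phrased so that it holds for either
    order of the ends.\<close>
  have KD: "x \<le> a \<longleftrightarrow> a < y" if "{x, y} \<in> K" for x y
    using that by (auto simp: K_def doubleton_eq_iff)
  have MD: "a < x \<and> a < y \<and> (\<exists>i<b. x = l i \<and> y = r i \<or> x = r i \<and> y = l i)" if xy: "{x, y} \<in> M" for x y
  proof -
    obtain i where "i < b" "{x, y} = {l i, r i}"
      using xy by (auto simp: M_def)
    then show ?thesis
      using range(1,2)[of i] by (auto simp: doubleton_eq_iff)
  qed
  have KM: "{x, y} \<in> M" if "{x, y} \<in> K \<union> M" "a < x" "a < y" for x y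
    using that KD[of x y] by auto
  have low: "a < x \<or> a < y" if "{x, y} \<in> K \<union> M" for x y
    using that KD[of x y] MD[of x y] by auto
  \<comment> \<open>A triangle of \<open>K \<union> M\<close> has at most one vertex up to
    \<open>a\<close>. With one, its other two vertices are matched and it is in \<open>T\<close>;
    with none, \<open>x\<close> would have two matching partners.\<close>
  have triT: "\<exists>A\<in>?P 2 - (K \<union> M). A \<subseteq> t" if t: "t \<in> ?P 3" "t \<notin> T" for t
  proof (rule ccontr)
    assume "\<not> ?thesis"
    then have all: "A \<in> K \<union> M" if "A \<in> ?P 2" "A \<subseteq> t" for A
      using that by blast
    have "card t = 3"
      using t(1) by (simp add: subsets_of_size_def)
    then obtain x y z where xyz: "t = {x, y, z}" "x \<noteq> y" "y \<noteq> z" "x \<noteq> z"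
      by (metis card_3_iff)
    have V: "x \<in> {1..n}" "y \<in> {1..n}" "z \<in> {1..n}"
      using t(1) xyz(1) by (auto simp: subsets_of_size_def)
    have pairs: "{p, q} \<in> K \<union> M" if "p \<in> t" "q \<in> t" "p \<noteq> q" for p q
      using all[of "{p, q}"] that V xyz(1) by (auto simp: subsets_of_size_def)
    have mem: "{p, q, s} \<in> T" if p: "p \<le> a" "p \<in> {1..n}" and qs: "{q, s} \<in> M" for p q s
    proof -
      obtain i where "i < b" "{q, s} = {l i, r i}"
        using MD[OF qs] by auto
      then have "{p, q, s} = (\<lambda>(x, i). {x, l i, r i}) (p, i)"
        by auto
      then show ?thesis
        unfolding T_def using p \<open>i < b\<close> by (intro image_eqI) auto
    qed
    have step: "p > a" if "t = {p, q, s}" "p \<noteq> q" "p \<noteq> s" "q \<noteq> s" for p q s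
    proof (rule ccontr)
      assume p: "\<not> a < p"
      have "a < q" "a < s"
        using p low[OF pairs[of p q]] low[OF pairs[of p s]] that by auto
      then have "{q, s} \<in> M"
        using KM[OF pairs[of q s]] that by auto
      moreover have "p \<in> {1..n}"
        using V xyz(1) that(1) by auto
      ultimately have "{p, q, s} \<in> T"
        using mem[of p q s] p by simp
      then show False
        using t(2) that(1) by simp
    qed
    have "a < x" "a < y" "a < z"
      using step[of x y z] step[of y x z] step[of z x y] xyz by (auto simp: insert_commute)
    then have "{x, y} \<in> M" "{x, z} \<in> M"
      using KM pairs xyz by auto
    from MD[OF this(1)] MD[OF this(2)] have "y = z"
      by (auto simp: l_def r_def) presburger+
    then show False
      using xyz by simp
  qed
  have DP: "D \<inter> ?P 2 = ?P 2 - (K \<union> M)" "D \<inter> ?P 3 = T"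
    using T3 subsets_of_size_disjoint[of 2 3 n] by (auto simp: D_def)
  have DU: "D \<subseteq> ?P 2 \<union> ?P 3"
    using T3 by (auto simp: D_def)
  show thesis
  proof (rule that)
    show "dominating (inclusion_graph n 3 2) D"
    proof (subst dominating_inclusion_graph_iff, simp, intro conjI ballI)
      show "D \<subseteq> ?P 2 \<union> ?P 3"
        by (rule DU)
      show "\<exists>B\<in>D \<inter> ?P 3. A \<subseteq> B" if "A \<in> ?P 2 - D" for A
        unfolding DP using that coverT[of A] by (auto simp: D_def)
      show "\<exists>A\<in>D \<inter> ?P 2. A \<subseteq> B" if "B \<in> ?P 3 - D" for B
        unfolding DP using that triT[of B] by (auto simp: D_def)
    qed
    show "independent_vertices (inclusion_graph n 3 2) D"
      unfolding independent_vertices_def verts_inclusion_graph adjacent_inclusion_graph_iff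
      using DU DP pairT by blast
    have injK: "inj_on (\<lambda>(x, y). {x, y}) ({1..a} \<times> {a+1..n})"
      by (auto simp: inj_on_def doubleton_eq_iff)
    have cK: "card K = a * (2 * b)"
      unfolding K_def using card_image[OF injK] by (simp add: card_cartesian_product n)
    have cM: "card M = b"
      unfolding M_def by (subst card_image) (auto simp: inj_on_def doubleton_eq_iff l_def r_def)
    have fin: "finite K" "finite M"
      by (auto simp: K_def M_def)
    have "K \<inter> M = {}"
    proof (rule equals0I)
      fix A assume A: "A \<in> K \<inter> M"
      then obtain x y where "A = {x, y}"
        by (auto simp: K_def)
      then show False
        using A KD[of x y] MD[of x y] by auto
    qed
    then have cKM: "card (K \<union> M) = a * (2 * b) + b"
      using fin cK cM by (simp add: card_Un_disjoint)
    \<comment> \<open>Keeps the natural-number subtraction in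
      \<open>card (?P 2 - (K \<union> M))\<close> from truncating.\<close>
    have le: "card (K \<union> M) \<le> n choose 2"
      using K2 M2 card_mono[OF finite_subsets_of_size, of "K \<union> M" n 2]
      by (simp add: card_subsets_of_size)
    have "card T \<le> a * b"
      unfolding T_def by (rule order_trans[OF card_image_le]) (simp_all add: card_cartesian_product)
    moreover have "card D \<le> card (?P 2 - (K \<union> M)) + card T"
      unfolding D_def by (rule card_Un_le)
    moreover have "card (?P 2 - (K \<union> M)) = (n choose 2) - card (K \<union> M)"
      using fin K2 M2 by (subst card_Diff_subset) (auto simp: card_subsets_of_size)
    ultimately show "card D + (a + 1) * b \<le> n choose 2"
      using le cKM by (simp add: algebra_simps)
  qed
qed

section \<open>Choice of the parameters and conclusion\<close>

text \<open>Since (n + 1)^2 - 8 (a + 1) b = (a + 1 - 2 b)^2, it suffices to make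
  \<open>a + 1\<close> and \<open>2 * b\<close> differ by at most 2.\<close>

lemma square_div_8_split:
  fixes n :: nat
  assumes "n \<ge> 3"
  obtains a b where "n = a + 2 * b" "a \<ge> 1" "b \<ge> 1" "(n + 1)^2 div 8 = (a + 1) * b"
proof -
  define q where "q = (n + 1) div 4"
  define s where "s = (n + 1) mod 4"
  have m: "n + 1 = 4 * q + s" and s4: "s < 4"
    by (simp_all add: q_def s_def)
  have q1: "q \<ge> 1"
    using assms m s4 by linarith
  have sq: "(n + 1)^2 = 8 * (2 * q^2 + s * q) + s^2"
    unfolding m by (simp add: power2_eq_square algebra_simps)
  have div8: "(8 * k + j) div 8 = k" if "j < 8" for k j :: nat
    using that by simp
  show thesis
  proof (cases "s = 3")
    case True
    \<comment> \<open>Taking \<open>b = q\<close> would leave remainder 9; \<open>b = q + 1\<close>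
      makes the difference -1 and the remainder 1.\<close>
    then have "(n + 1)^2 = 8 * ((2 * q + 1) * (q + 1)) + 1"
      using sq by (simp add: power2_eq_square algebra_simps)
    then have "(n + 1)^2 div 8 = (2 * q + 1) * (q + 1)"
      using div8[of 1] by presburger
    then show thesis
      using that[of "2 * q" "q + 1"] m q1 True by simp
  next
    case False
    then have "s \<in> {0, 1, 2}"
      using s4 by auto
    then have "s^2 < 8"
      by auto
    then have "(n + 1)^2 div 8 = 2 * q^2 + s * q"
      unfolding sq by (rule div8)
    \<comment> \<open>With \<open>a + 1 = 2 * q + s\<close> and \<open>b = q\<close> the difference
      is \<open>s\<close>; \<open>q \<ge> 1\<close> makes \<open>- 1 + 1\<close> cancel.\<close>
    also have "\<dots> = (2 * q + s - 1 + 1) * q"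
      using q1 by (simp add: power2_eq_square algebra_simps)
    finally show thesis
      using that[of "2 * q + s - 1" q] m q1 by simp
  qed
qed

theorem theorem1:
  fixes n :: nat
  assumes "n \<ge> 3"
  shows "independent_domination_number (inclusion_graph n 3 2)
           = domination_number (inclusion_graph n 3 2)
       \<and> int (domination_number (inclusion_graph n 3 2))
           = int (n choose 2) - \<lfloor>(real n + 1)^2 / 8\<rfloor>"
proof -
  let ?G = "inclusion_graph n 3 2"
  obtain a b where ab: "n = a + 2 * b" "a \<ge> 1" "b \<ge> 1" "(n + 1)^2 div 8 = (a + 1) * b"
    using square_div_8_split[OF assms] .
  obtain D where D: "dominating ?G D" "independent_vertices ?G D"
    and "card D + (n + 1)^2 div 8 \<le> n choose 2"
    using independent_dominating_set_construction[OF ab(1-3)] ab(4) by metis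
  then have cD: "card D + (n + 1)^2 div 8 = n choose 2"
    using card_dominating_ge[OF D(1)] by linarith
  \<comment> \<open>\<open>D\<close> is smallest among all dominating sets and is independent, so it
    attains both minima.\<close>
  have min: "card D \<le> card D'" if "dominating ?G D'" for D'
    using card_dominating_ge[OF that] cD by linarith
  have "domination_number ?G = card D"
    unfolding domination_number_def using D min by (intro Least_equality) auto
  moreover have "independent_domination_number ?G = card D"
    unfolding independent_domination_number_def using D min by (intro Least_equality) auto
  moreover have "\<lfloor>(real n + 1)^2 / 8\<rfloor> = int ((n + 1)^2 div 8)"
    using floor_divide_of_nat_eq[of "(n + 1)^2" 8] by (simp add: add.commute)
  ultimately show ?thesis
    using cD by linarith
qed

end
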